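(* Let $n \in \mathbb{N}$. Let $$H_{n+1} = \left\{ f \in C^{n+1}([-1,1]) \;:\; \inf_{p \in \Pi_n} \|f - p\|_\infty = \frac{\|f^{(n+1)}\|_\infty}{2^n (n+1)!} \right\}.$$ Then $H_{n+1} = \Pi_{n+1}$.
   Context: All functions are real-valued. For $k \in \mathbb{N}$, $\Pi_k$ denotes the set of polynomials with real coefficients of degree less than or equal to $k$, regarded here as functions on $[-1,1]$. $C^{n+1}([-1,1])$ is the set of $(n+1)$ times continuously differentiable functions $f : [-1,1] \to \mathbb{R}$ (with one-sided derivatives at the endpoints), $f^{(n+1)}$ is the $(n+1)$-th derivative of $f$, and $\|\cdot\|_\infty$ is the supremum norm over $[-1,1]$. *)

theory Defs
  imports "HOL-Analysis.Analysis" "HOL-Computational_Algebra.Polynomial"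
begin

text \<open>A function on \<open>[-1,1]\<close> is represented by its extensional representative, i.e. a function
  on the reals that is \<^term>\<open>undefined\<close> outside the interval. Set equality then means equality
  of functions on \<open>[-1,1]\<close>.\<close>

abbreviation I :: "real set" where
  "I \<equiv> {-1..1}"

definition Pi_poly :: "nat \<Rightarrow> (real \<Rightarrow> real) set" where
  "Pi_poly k = {restrict (poly p) I | p :: real poly. degree p \<le> k}"

text \<open>The derivatives are taken within \<open>[-1,1]\<close>, hence are one-sided at the endpoints.
  Only the values at points of \<open>[-1,1]\<close> are meaningful.\<close>

primrec nth_deriv :: "nat \<Rightarrow> (real \<Rightarrow> real) \<Rightarrow> real \<Rightarrow> real" where
  "nth_deriv 0 f = f"
| "nth_deriv (Suc k) f = (\<lambda>x. vector_derivative (nth_deriv k f) (at x within I))"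

definition C_diff :: "nat \<Rightarrow> (real \<Rightarrow> real) set" where
  "C_diff k = {f \<in> extensional I.
     (\<forall>j<k. nth_deriv j f differentiable_on I) \<and> continuous_on I (nth_deriv k f)}"

definition sup_norm :: "(real \<Rightarrow> real) \<Rightarrow> real" where
  "sup_norm g = (SUP x\<in>I. \<bar>g x\<bar>)"

end

theory Submission imports Defs
begin

text \<open>For a polynomial of degree at most \<open>n + 1\<close> with leading coefficient \<open>a\<close>, subtracting
  \<open>a / 2 ^ n\<close> times the Chebyshev polynomial \<open>T\<close> of degree \<open>n + 1\<close> gives an approximation with error
  \<open>\<bar>a\<bar> / 2 ^ n\<close>. No approximation is better, because the coefficient of degree \<open>n + 1\<close> is a linear
  combination of the values at the \<open>n + 2\<close> extremal points of \<open>T\<close> whose weights have the alternating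
  signs of \<open>T\<close>.

  Conversely, let \<open>f\<close> be extremal with error \<open>E\<close>, and let \<open>p\<close> interpolate \<open>f\<close> at the zeros of \<open>T\<close>.
  The error formula gives \<open>\<bar>f - p\<bar> \<le> E * \<bar>T\<bar>\<close>, so \<open>p\<close> is a best approximation and \<open>f - p\<close> can
  have modulus \<open>E\<close> only at extremal points of \<open>T\<close>. A perturbation argument then forces
  \<open>f - p = \<sigma> * E * T\<close> at all these points, with a fixed sign \<open>\<sigma>\<close>. Put \<open>P = p + \<sigma> * E * T\<close>. The
  \<open>(n + 1)\<close>-st derivative of \<open>f - P\<close> has constant sign, since that of \<open>P\<close> is the constant
  \<open>\<sigma>\<close> times the norm of that of \<open>f\<close>. Comparing the error formulas for the nodes without \<open>1\<close> and
  without \<open>- 1\<close> yields \<open>f = P\<close>.\<close>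

section \<open>Polynomials\<close>

lemma poly_eq_0_if_many_roots:
  fixes p :: "real poly"
  assumes "finite S" "degree p < card S" "\<And>x. x \<in> S \<Longrightarrow> poly p x = 0"
  shows "p = 0"
proof (rule ccontr)
  assume "p \<noteq> 0"
  then have "card S \<le> card {x. poly p x = 0}"
    using assms by (intro card_mono poly_roots_finite) auto
  also have "\<dots> \<le> degree p"
    using \<open>p \<noteq> 0\<close> by (rule card_poly_roots_bound)
  finally show False
    using assms(2) by simp
qed

text \<open>Newton's scheme: a new node is accommodated by adding a multiple of the product that
  vanishes at the old ones. The alternative \<open>S = {}\<close> is there because no degree lies
  below \<open>card {}\<close>.\<close>

lemma interpolation_poly_exists:
  fixes f :: "real \<Rightarrow> real"
  assumes "finite S"
  shows "\<exists>p. (S = {} \<or> degree p < card S) \<and> (\<forall>x\<in>S. poly p x = f x)"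
  using assms
proof (induction S)
  case (insert a S)
  then obtain p where p: "S = {} \<or> degree p < card S" "\<forall>x\<in>S. poly p x = f x"
    by blast
  define w where "w = (\<Prod>z\<in>S. [:- z, 1:])"
  have w0: "poly w x = 0" if "x \<in> S" for x
    using that insert.hyps by (auto simp: w_def poly_prod)
  have wa: "poly w a \<noteq> 0"
    using insert.hyps by (auto simp: w_def poly_prod)
  have dw: "degree w \<le> card S"
    using degree_prod_sum_le[OF insert.hyps(1), of "\<lambda>z. [:- z, 1:]"] by (simp add: w_def)
  show ?case
  proof (cases "S = {}")
    case True
    then show ?thesis
      by (intro exI[of _ "[:f a:]"]) auto
  next
    case False
    define q where "q = p + smult ((f a - poly p a) / poly w a) w"
    have "degree q \<le> card S"
      using p(1) False dw unfolding q_def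
      by (intro degree_add_le) (auto intro: order_trans[OF degree_smult_le])
    moreover have "\<forall>x\<in>insert a S. poly q x = f x"
      using w0 wa p(2) by (auto simp: q_def)
    ultimately show ?thesis
      using insert.hyps by (intro exI[of _ q]) auto
  qed
qed auto

lemma higher_pderiv_degree_le:
  fixes p :: "real poly"
  assumes "degree p \<le> m"
  shows "(pderiv ^^ m) p = [:fact m * coeff p m:]"
proof (rule poly_eqI)
  fix i
  show "coeff ((pderiv ^^ m) p) i = coeff [:fact m * coeff p m:] i"
    using assms
    by (cases i) (auto simp: coeff_higher_pderiv pochhammer_fact coeff_eq_0)
qed

section \<open>Higher derivatives on the interval\<close>

lemma nth_deriv_has_real_derivative:
  assumes "f \<in> C_diff m" "j < m" "x \<in> I"
  shows "(nth_deriv j f has_real_derivative nth_deriv (Suc j) f x) (at x within I)"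
  using assms
  by (auto simp: C_diff_def differentiable_on_def has_real_derivative_iff_has_vector_derivative
      vector_derivative_works)

lemma continuous_on_nth_deriv:
  assumes "f \<in> C_diff m" "j \<le> m"
  shows "continuous_on I (nth_deriv j f)"
  using assms
  by (cases "j = m") (auto simp: C_diff_def intro: differentiable_imp_continuous_on)

lemma nth_deriv_poly:
  assumes "x \<in> I"
  shows "nth_deriv j (restrict (poly p) I) x = poly ((pderiv ^^ j) p) x"
  using assms
proof (induction j arbitrary: x)
  case (Suc j)
  have "(poly ((pderiv ^^ j) p) has_vector_derivative poly ((pderiv ^^ Suc j) p) x) (at x within I)"
    using poly_DERIV[of "(pderiv ^^ j) p" x]
    by (simp add: has_real_derivative_iff_has_vector_derivative[symmetric]
        has_field_derivative_at_within)
  then have "(nth_deriv j (restrict (poly p) I) has_vector_derivative poly ((pderiv ^^ Suc j) p) x)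
      (at x within I)"
    by (rule has_vector_derivative_transform[rotated 2]) (use Suc in blast)+
  \<comment> \<open>Derivatives within a nondegenerate closed interval are unique, so the value
    chosen by \<open>vector_derivative\<close> is this one, also at the endpoints.\<close>
  then show ?case
    using vector_derivative_within_closed_interval[of "- 1" 1 x] Suc.prems
    by (simp del: restrict_apply)
qed simp

lemma poly_in_C_diff: "restrict (poly p) I \<in> C_diff m"
proof -
  have "nth_deriv j (restrict (poly p) I) differentiable_on I" for j
    unfolding differentiable_on_def
  proof
    fix x assume x: "x \<in> I"
    have "(poly ((pderiv ^^ j) p) has_derivative (*) (poly (pderiv ((pderiv ^^ j) p)) x))
        (at x within I)"
      using has_field_derivative_at_within[OF poly_DERIV] by (simp add: has_field_derivative_def)
    then have "(nth_deriv j (restrict (poly p) I) has_derivative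
        (*) (poly (pderiv ((pderiv ^^ j) p)) x)) (at x within I)"
      by (rule has_derivative_transform[rotated 2]) (use x in \<open>auto simp: nth_deriv_poly\<close>)
    then show "nth_deriv j (restrict (poly p) I) differentiable (at x within I)"
      by (rule differentiableI)
  qed
  then show ?thesis
    by (auto simp: C_diff_def intro: differentiable_imp_continuous_on)
qed

section \<open>Interpolation error\<close>

text \<open>Induction on the largest point of \<open>S\<close>. The last conjunct serves the
  induction: Rolle's theorem gives a zero strictly between \<open>Max S\<close> and the new maximum,
  and this zero is new because the earlier ones lie below some point of \<open>S\<close>.\<close>

lemma Rolle_zeros:
  fixes g g' :: "real \<Rightarrow> real"
  assumes der: "\<And>x. x \<in> I \<Longrightarrow> (g has_real_derivative g' x) (at x within I)"
    and "finite S" "S \<subseteq> I" "\<And>x. x \<in> S \<Longrightarrow> g x = 0"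
  shows "\<exists>S'. finite S' \<and> S' \<subseteq> I \<and> card S' = card S - 1 \<and> (\<forall>x\<in>S'. g' x = 0)
    \<and> (\<forall>x\<in>S'. \<exists>s\<in>S. x \<le> s)"
  using assms(2-)
proof (induction S rule: finite_linorder_max_induct)
  case (insert b S)
  then obtain S' where S': "finite S'" "S' \<subseteq> I" "card S' = card S - 1" "\<forall>x\<in>S'. g' x = 0"
      "\<forall>x\<in>S'. \<exists>s\<in>S. x \<le> s"
    by (metis insert_subset insertCI)
  show ?case
  proof (cases "S = {}")
    case True
    then show ?thesis
      by (intro exI[of _ "{}"]) auto
  next
    case False
    define a where "a = Max S"
    have a: "a \<in> S" "\<And>s. s \<in> S \<Longrightarrow> s \<le> a"
      using insert.hyps False by (auto simp: a_def)
    have ab: "a < b" "a \<in> I" "b \<in> I" "g a = 0" "g b = 0"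
      using a insert by auto
    have "continuous_on I g"
      using der by (meson DERIV_continuous continuous_on_eq_continuous_within)
    then have "continuous_on {a..b} g"
      by (rule continuous_on_subset) (use ab in auto)
    moreover have "(g has_real_derivative g' x) (at x)" if "a < x" "x < b" for x
    proof -
      have "x \<in> I" "x \<in> interior I"
        using ab that by auto
      then show ?thesis
        using der[of x] at_within_interior[of x I] by metis
    qed
    ultimately obtain z where z: "a < z" "z < b" "(*) (g' z) = (\<lambda>v. 0)"
      using Rolle_deriv[of a b g "\<lambda>x. (*) (g' x)"] ab
      unfolding has_field_derivative_def by auto
    then have "g' z = 0"
      by (metis mult.right_neutral)
    have "z \<notin> S'"
      using S'(5) a(2) z(1) by fastforce
    then have "card (insert z S') = card (insert b S) - 1"
      using S'(1,3) insert.hyps False by (auto simp: card_gt_0_iff)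
    then show ?thesis
      using S' z \<open>g' z = 0\<close> ab by (intro exI[of _ "insert z S'"]) (auto intro: less_imp_le)
  qed
qed (auto intro: exI[of _ "{}"])

text \<open>Each differentiation costs at most one zero. The chain \<open>D\<close> of derivatives
  is abstract so that it can mix \<open>nth_deriv\<close> of a function with \<open>pderiv\<close>
  of a polynomial.\<close>

lemma Rolle_higher:
  fixes D :: "nat \<Rightarrow> real \<Rightarrow> real"
  assumes "\<And>j x. j < m \<Longrightarrow> x \<in> I \<Longrightarrow> (D j has_real_derivative D (Suc j) x) (at x within I)"
    and "finite S" "S \<subseteq> I" "m < card S" "\<And>x. x \<in> S \<Longrightarrow> D 0 x = 0"
  shows "\<exists>\<xi>\<in>I. D m \<xi> = 0"
  using assms
proof (induction m arbitrary: D S)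
  case 0
  then obtain x where "x \<in> S"
    by (metis card_gt_0_iff ex_in_conv)
  with 0 show ?case
    by blast
next
  case (Suc m)
  obtain S' where S': "finite S'" "S' \<subseteq> I" "card S' = card S - 1" "\<forall>x\<in>S'. D 1 x = 0"
    using Rolle_zeros[of "D 0" "D 1" S] Suc.prems by fastforce
  show ?case
    using Suc.IH[of "\<lambda>j. D (Suc j)" S'] Suc.prems S' by auto
qed

text \<open>Allowing \<open>degree P = m\<close> lets the formula absorb the leading term of \<open>P\<close> into the
  derivative.\<close>

lemma interpolation_error:
  assumes f: "f \<in> C_diff m" and w: "degree w = m" and Z: "finite Z" "Z \<subseteq> I" "card Z = m"
    and wZ: "\<And>z. z \<in> Z \<Longrightarrow> poly w z = 0" and w0: "w \<noteq> 0"
    and P: "degree P \<le> m" "\<And>z. z \<in> Z \<Longrightarrow> poly P z = f z" and x: "x \<in> I"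
  shows "\<exists>\<xi>\<in>I. f x - poly P x
    = (nth_deriv m f \<xi> - fact m * coeff P m) / (fact m * lead_coeff w) * poly w x"
proof (cases "x \<in> Z")
  case True
  then show ?thesis
    using P(2) wZ x by auto
next
  case False
  have wx: "poly w x \<noteq> 0"
  proof
    assume "poly w x = 0"
    then have "w = 0"
      using False Z w wZ by (intro poly_eq_0_if_many_roots[of "insert x Z"]) auto
    with w0 show False ..
  qed
  \<comment> \<open>This \<open>c\<close> makes \<open>Q\<close> agree with \<open>f\<close> at
    \<open>x\<close> as well as on \<open>Z\<close>, which gives the \<open>m + 1\<close> zeros
    needed for \<open>Rolle_higher\<close>.\<close>
  define c where "c = (f x - poly P x) / poly w x"
  define Q where "Q = P + smult c w"
  define D where "D = (\<lambda>j y. nth_deriv j f y - poly ((pderiv ^^ j) Q) y)"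
  have "\<exists>\<xi>\<in>I. D m \<xi> = 0"
  proof (rule Rolle_higher[where S = "insert x Z"])
    fix j y assume "j < m" "y \<in> I"
    then show "(D j has_real_derivative D (Suc j) y) (at y within I)"
      using DERIV_diff[OF nth_deriv_has_real_derivative[OF f]
          has_field_derivative_at_within[OF poly_DERIV[of "(pderiv ^^ j) Q"]]]
      by (simp add: D_def)
  qed (use Z x wx False P(2) wZ in \<open>auto simp: D_def Q_def c_def\<close>)
  then obtain \<xi> where \<xi>: "\<xi> \<in> I" "D m \<xi> = 0"
    by blast
  have "degree Q \<le> m"
    unfolding Q_def using P(1) w by (intro degree_add_le) (auto intro: order_trans[OF degree_smult_le])
  then have "nth_deriv m f \<xi> = fact m * (coeff P m + c * lead_coeff w)"
    using \<xi>(2) w by (simp add: D_def higher_pderiv_degree_le Q_def)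
  then have "c = (nth_deriv m f \<xi> - fact m * coeff P m) / (fact m * lead_coeff w)"
    using w0 by (simp add: field_simps)
  then have "f x - poly P x
      = (nth_deriv m f \<xi> - fact m * coeff P m) / (fact m * lead_coeff w) * poly w x"
    using wx by (auto simp: c_def field_simps)
  with \<xi>(1) show ?thesis
    by blast
qed

section \<open>Decreasing nodes\<close>

text \<open>Nodes are selected by index, so that \<open>{..N} - {k}\<close> deletes one of them. The
  value at the deleted node is then the denominator of the Lagrange basis polynomial.\<close>

definition nodal :: "(nat \<Rightarrow> real) \<Rightarrow> nat set \<Rightarrow> real poly" where
  "nodal y A = (\<Prod>l\<in>A. [:- y l, 1:])"

lemma poly_nodal: "poly (nodal y A) x = (\<Prod>l\<in>A. x - y l)"
  by (simp add: nodal_def poly_prod)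

lemma degree_nodal [simp]: "degree (nodal y A) = card A"
  by (simp add: nodal_def degree_prod_eq_sum_degree)

lemma lead_coeff_nodal: "coeff (nodal y A) (card A) = 1"
  using lead_coeff_prod[of "\<lambda>l. [:- y l, 1:]" A] degree_nodal[of y A]
  by (simp add: nodal_def)

lemma nodal_neq_0 [simp]: "nodal y A \<noteq> 0"
  using lead_coeff_nodal[of y A] by auto

lemma nodal_eq_0: "finite A \<Longrightarrow> l \<in> A \<Longrightarrow> poly (nodal y A) (y l) = 0"
  by (auto simp: poly_nodal)

text \<open>The \<open>k\<close> nodes before \<open>y k\<close> are larger and contribute one
  negative factor each; the later ones contribute positive factors.\<close>

lemma nodal_sign:
  assumes "\<And>i j. i < j \<Longrightarrow> j \<le> N \<Longrightarrow> y j < y i" "k \<le> N"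
  shows "0 < (- 1) ^ k * poly (nodal y ({..N} - {k})) (y k)"
proof -
  have "{..N} - {k} = {..<k} \<union> {k<..N}"
    using assms(2) by auto
  then have "poly (nodal y ({..N} - {k})) (y k)
      = (\<Prod>l<k. y k - y l) * (\<Prod>l\<in>{k<..N}. y k - y l)"
    unfolding poly_nodal by (simp add: prod.union_disjoint[symmetric] disjoint_iff)
  also have "(\<Prod>l<k. y k - y l) = (- 1) ^ k * (\<Prod>l<k. y l - y k)"
    using prod.distrib[of "\<lambda>_. - 1" "\<lambda>l. y l - y k" "{..<k}"] by simp
  finally have "(- 1) ^ k * poly (nodal y ({..N} - {k})) (y k)
      = (\<Prod>l<k. y l - y k) * (\<Prod>l\<in>{k<..N}. y k - y l)"
    by (simp flip: mult.assoc power_add)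
  moreover have "0 < (\<Prod>l<k. y l - y k)" "0 < (\<Prod>l\<in>{k<..N}. y k - y l)"
    using assms by (auto intro!: prod_pos)
  ultimately show ?thesis
    by simp
qed

text \<open>This is the divided difference of \<open>q\<close>: by uniqueness \<open>q\<close>
  equals its Lagrange form \<open>s\<close>, a combination of monic polynomials of degree
  \<open>N\<close>.\<close>

lemma lead_coeff_interpolation:
  assumes y: "\<And>i j. i < j \<Longrightarrow> j \<le> N \<Longrightarrow> y j < y i" and q: "degree q \<le> N"
  shows "coeff q N = (\<Sum>k\<le>N. poly q (y k) / poly (nodal y ({..N} - {k})) (y k))"
proof -
  define c where "c = (\<lambda>k. poly q (y k) / poly (nodal y ({..N} - {k})) (y k))"
  define s where "s = (\<Sum>k\<le>N. smult (c k) (nodal y ({..N} - {k})))"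
  have inj: "inj_on y {..N}"
    by (rule linorder_inj_onI) (use y in \<open>force+\<close>)
  have "degree s \<le> N"
    unfolding s_def by (intro degree_sum_le) (auto intro: order_trans[OF degree_smult_le])
  moreover have "poly s (y j) = poly q (y j)" if "j \<le> N" for j
  proof -
    have "poly s (y j) = (\<Sum>k\<le>N. if k = j then poly q (y j) else 0)"
      unfolding s_def poly_sum
    proof (rule sum.cong)
      fix k assume "k \<in> {..N}"
      then show "poly (smult (c k) (nodal y ({..N} - {k}))) (y j) = (if k = j then poly q (y j) else 0)"
        using nodal_sign[where y = y and N = N and k = k] y that
        by (force simp: c_def nodal_eq_0)
    qed simp
    then show ?thesis
      using that by simp
  qed
  ultimately have "q - s = 0"
    using inj le_imp_less_Suc[OF degree_diff_le[OF q, of s]]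
    by (intro poly_eq_0_if_many_roots[of "y ` {..N}"]) (auto simp: card_image)
  then have "coeff q N = (\<Sum>k\<le>N. c k * coeff (nodal y ({..N} - {k})) N)"
    by (simp add: s_def coeff_sum)
  also have "\<dots> = (\<Sum>k\<le>N. c k)"
  proof (rule sum.cong)
    fix k assume "k \<in> {..N}"
    then show "c k * coeff (nodal y ({..N} - {k})) N = c k"
      using lead_coeff_nodal[of y "{..N} - {k}"] by simp
  qed simp
  finally show ?thesis
    by (simp add: c_def)
qed


section \<open>Chebyshev polynomials\<close>

text \<open>Chebyshev polynomials of the first kind by their three-term recurrence;
  \<open>pCons 0\<close> multiplies by the variable.\<close>

fun cheb :: "nat \<Rightarrow> real poly" where
  "cheb 0 = 1"
| "cheb (Suc 0) = [:0, 1:]"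
| "cheb (Suc (Suc n)) = smult 2 (pCons 0 (cheb (Suc n))) - cheb n"

lemma poly_cheb_cos: "poly (cheb n) (cos t) = cos (real n * t)"
proof (induction n rule: cheb.induct)
  case (3 n)
  have "cos ((real n + 2) * t) + cos (real n * t) = 2 * cos t * cos ((real n + 1) * t)"
    using cos_add[of "(real n + 1) * t" t] cos_diff[of "(real n + 1) * t" t]
    by (simp add: algebra_simps)
  then show ?case
    using 3 by (simp add: algebra_simps)
qed auto

lemma degree_cheb_le: "degree (cheb n) \<le> n"
  by (induction n rule: cheb.induct)
     (auto intro!: degree_diff_le order_trans[OF degree_smult_le] order_trans[OF degree_pCons_le])

lemma coeff_cheb: "coeff (cheb (Suc n)) (Suc n) = 2 ^ n"
proof (induction n)
  case (Suc n)
  have "coeff (cheb n) (Suc (Suc n)) = 0"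
    by (intro coeff_eq_0 le_less_trans[OF degree_cheb_le]) simp
  with Suc show ?case
    by simp
qed simp

lemma degree_cheb: "degree (cheb (Suc n)) = Suc n"
  using coeff_cheb[of n] by (intro antisym degree_cheb_le le_degree) simp

lemma abs_cheb_le_1:
  assumes "x \<in> I"
  shows "\<bar>poly (cheb n) x\<bar> \<le> 1"
  using poly_cheb_cos[of n "arccos x"] assms by simp

text \<open>For \<open>0 < N\<close> and \<open>k \<le> N\<close> these are the extremal points of
  \<open>cheb N\<close>, numbered from right to left because cosine decreases on
  \<open>[0, pi]\<close>.\<close>

definition cheb_ext :: "nat \<Rightarrow> nat \<Rightarrow> real" where
  "cheb_ext N k = cos (real k * pi / real N)"

lemma cheb_ext_in_I: "cheb_ext N k \<in> I"
  by (simp add: cheb_ext_def)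

lemma cheb_ext_0: "cheb_ext N 0 = 1"
  by (simp add: cheb_ext_def)

lemma cheb_ext_N: "0 < N \<Longrightarrow> cheb_ext N N = - 1"
  by (simp add: cheb_ext_def)

lemma cheb_ext_decreasing:
  assumes "i < j" "j \<le> N"
  shows "cheb_ext N j < cheb_ext N i"
  unfolding cheb_ext_def
  using assms by (intro cos_monotone_0_pi) (auto simp: field_simps)

lemma poly_cheb_ext:
  assumes "0 < N"
  shows "poly (cheb N) (cheb_ext N k) = (- 1) ^ k"
  using assms by (simp add: cheb_ext_def poly_cheb_cos)

text \<open>Where the cosine has modulus 1 the sine vanishes, so \<open>N * arccos x\<close> is an
  integer multiple of \<open>pi\<close>; the range of \<open>arccos\<close> bounds the
  integer.\<close>

lemma cheb_extremal_points:
  assumes "0 < N" "x \<in> I" "\<bar>poly (cheb N) x\<bar> = 1"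
  shows "\<exists>k\<le>N. x = cheb_ext N k"
proof -
  define t where "t = arccos x"
  have t: "cos t = x" "0 \<le> t" "t \<le> pi"
    using assms(2) by (auto simp: t_def arccos_lbound arccos_ubound)
  have "\<bar>cos (real N * t)\<bar> = 1"
    using poly_cheb_cos[of N t] t assms(3) by simp
  then have "(cos (real N * t))\<^sup>2 = 1"
    using power2_abs[of "cos (real N * t)"] by simp
  then have "sin (real N * t) = 0"
    using sin_cos_squared_add[of "real N * t"] by simp
  then obtain i :: int where i: "real N * t = of_int i * pi"
    by (auto simp: sin_zero_iff_int2)
  have "0 * pi \<le> of_int i * pi" "of_int i * pi \<le> real N * pi"
    unfolding i[symmetric] using t by (auto intro: mult_left_mono)
  then have "0 \<le> i" "of_int i \<le> real N"
    unfolding mult_le_cancel_right_pos[OF pi_gt_zero] by simp_all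
  then obtain k where k: "i = int k" "k \<le> N"
    using nonneg_int_cases by auto
  then have "t = real k * pi / real N"
    using i assms(1) by (simp add: eq_divide_eq mult.commute)
  then have "x = cheb_ext N k"
    unfolding cheb_ext_def t(1)[symmetric] by (rule arg_cong)
  with k(2) show ?thesis
    by blast
qed

lemma cheb_zeros:
  "\<exists>Z. finite Z \<and> Z \<subseteq> I \<and> card Z = N \<and> (\<forall>z\<in>Z. poly (cheb N) z = 0)"
proof -
  \<comment> \<open>Multiplied by \<open>N\<close>, these angles become odd multiples of
    \<open>pi / 2\<close>.\<close>
  define z where "z = (\<lambda>k. cos ((2 * real k + 1) * pi / (2 * real N)))"
  have "z j < z i" if "i < j" "j < N" for i j
  proof -
    have "2 * real j + 1 \<le> 2 * real N"
      using that by linarith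
    then have "(2 * real j + 1) * pi / (2 * real N) \<le> pi"
      using that mult_right_mono[of "2 * real j + 1" "2 * real N" pi] by (simp add: divide_simps mult_ac)
    moreover have "(2 * real i + 1) * pi / (2 * real N) < (2 * real j + 1) * pi / (2 * real N)"
      using that by (intro divide_strict_right_mono mult_strict_right_mono) auto
    ultimately show ?thesis
      unfolding z_def by (intro cos_monotone_0_pi) auto
  qed
  then have "inj_on z {..<N}"
    by (intro linorder_inj_onI) force+
  then have "card (z ` {..<N}) = N"
    by (simp add: card_image)
  moreover have "poly (cheb N) (z k) = 0" if "k < N" for k
  proof -
    have "real N * ((2 * real k + 1) * pi / (2 * real N)) = real k * pi + pi / 2"
      using that by (simp add: field_simps)
    then show ?thesis
      by (simp add: z_def poly_cheb_cos cos_add)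
  qed
  ultimately show ?thesis
    by (intro exI[of _ "z ` {..<N}"]) (auto simp: z_def)
qed

section \<open>The supremum norm\<close>

text \<open>Compactness turns the supremum into a maximum. Without a bound on \<open>g\<close> the
  real \<open>SUP\<close> would be an unspecified value.\<close>

lemma sup_norm_attained:
  assumes "continuous_on I g"
  obtains z where "z \<in> I" "sup_norm g = \<bar>g z\<bar>" "\<And>x. x \<in> I \<Longrightarrow> \<bar>g x\<bar> \<le> \<bar>g z\<bar>"
proof -
  obtain z where z: "z \<in> I" "\<And>x. x \<in> I \<Longrightarrow> \<bar>g x\<bar> \<le> \<bar>g z\<bar>"
    using continuous_attains_sup[of I "\<lambda>x. \<bar>g x\<bar>"] continuous_on_rabs[OF assms] by force
  moreover have "sup_norm g = \<bar>g z\<bar>"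
    unfolding sup_norm_def using z by (intro cSup_eq_maximum) auto
  ultimately show ?thesis
    using that by blast
qed

lemma abs_le_sup_norm:
  assumes "continuous_on I g" "x \<in> I"
  shows "\<bar>g x\<bar> \<le> sup_norm g"
  using sup_norm_attained[OF assms(1)] assms(2) by metis

lemma sup_norm_nonneg: "continuous_on I g \<Longrightarrow> 0 \<le> sup_norm g"
  by (metis sup_norm_attained abs_ge_zero)

lemma sup_norm_le:
  assumes "\<And>x. x \<in> I \<Longrightarrow> \<bar>g x\<bar> \<le> B"
  shows "sup_norm g \<le> B"
  unfolding sup_norm_def using assms by (intro cSUP_least) auto

lemma sup_norm_const:
  assumes "\<And>x. x \<in> I \<Longrightarrow> g x = c"
  shows "sup_norm g = \<bar>c\<bar>"
  unfolding sup_norm_def using assms by (subst SUP_cong[OF refl, of _ _ "\<lambda>_. \<bar>c\<bar>"]) auto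

section \<open>The error of best approximation\<close>

lemma continuous_on_poly_error:
  assumes "f \<in> C_diff m" "p \<in> Pi_poly n"
  shows "continuous_on I (\<lambda>x. f x - p x)"
proof -
  have "continuous_on I p"
    using assms(2) continuous_on_nth_deriv[OF poly_in_C_diff, of 0] by (auto simp: Pi_poly_def)
  then show ?thesis
    using continuous_on_nth_deriv[OF assms(1), of 0] by (auto intro: continuous_on_diff)
qed

lemma best_approx_le:
  assumes "f \<in> C_diff m" "degree p \<le> n"
  shows "(INF p\<in>Pi_poly n. sup_norm (\<lambda>x. f x - p x)) \<le> sup_norm (\<lambda>x. f x - restrict (poly p) I x)"
proof (rule cINF_lower)
  show "bdd_below ((\<lambda>p. sup_norm (\<lambda>x. f x - p x)) ` Pi_poly n)"
    using sup_norm_nonneg[OF continuous_on_poly_error[OF assms(1)]] by (intro bdd_belowI2[of _ 0])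
qed (use assms(2) in \<open>unfold Pi_poly_def, blast\<close>)

text \<open>Reduces a lower bound on the infimum to pointwise error bounds for plain polynomials,
  without restrictions or suprema.\<close>

lemma best_approx_ge:
  assumes "f \<in> C_diff m"
    and "\<And>p B. degree p \<le> n \<Longrightarrow> (\<And>x. x \<in> I \<Longrightarrow> \<bar>f x - poly p x\<bar> \<le> B) \<Longrightarrow> E \<le> B"
  shows "E \<le> (INF p\<in>Pi_poly n. sup_norm (\<lambda>x. f x - p x))"
proof (rule cINF_greatest)
  show "Pi_poly n \<noteq> {}"
    by (auto simp: Pi_poly_def intro: exI[of _ 0])
  fix q assume q: "q \<in> Pi_poly n"
  then obtain p where p: "q = restrict (poly p) I" "degree p \<le> n"
    by (auto simp: Pi_poly_def)
  show "E \<le> sup_norm (\<lambda>x. f x - q x)"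
    using abs_le_sup_norm[OF continuous_on_poly_error[OF assms(1) q]] p
    by (intro assms(2)[of p]) auto
qed

section \<open>Polynomials of degree at most \<open>n + 1\<close>\<close>

lemma degree_le_if_coeff_eq_0: "degree p \<le> Suc n \<Longrightarrow> coeff p (Suc n) = 0 \<Longrightarrow> degree p \<le> n"
  using eq_zero_or_degree_less[of p "Suc n"] by (auto simp: le_Suc_eq)

text \<open>The weights \<open>1 / w k\<close> have the signs of \<open>cheb (Suc n)\<close> at the
  nodes. The triangle inequality therefore bounds the coefficient by \<open>B\<close> times the same
  formula for \<open>cheb (Suc n)\<close>, whose leading coefficient is
  \<open>2 ^ n\<close>.\<close>

lemma abs_coeff_le_cheb:
  assumes q: "degree q \<le> Suc n" and B: "\<And>x. x \<in> I \<Longrightarrow> \<bar>poly q x\<bar> \<le> B"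
  shows "\<bar>coeff q (Suc n)\<bar> \<le> B * 2 ^ n"
proof -
  define y where "y = cheb_ext (Suc n)"
  define w where "w = (\<lambda>k. poly (nodal y ({..Suc n} - {k})) (y k))"
  have y: "\<And>i j. i < j \<Longrightarrow> j \<le> Suc n \<Longrightarrow> y j < y i"
    by (simp add: y_def cheb_ext_decreasing)
  have w: "poly (cheb (Suc n)) (y k) / w k = 1 / \<bar>w k\<bar>" if "k \<le> Suc n" for k
    using nodal_sign[where y = y, OF y that] poly_cheb_ext[of "Suc n" k]
    by (cases "even k") (auto simp: w_def y_def abs_if)
  have "\<bar>coeff q (Suc n)\<bar> \<le> (\<Sum>k\<le>Suc n. \<bar>poly q (y k) / w k\<bar>)"
    using lead_coeff_interpolation[where y = y, OF y q] unfolding w_def by (metis sum_abs)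
  also have "\<dots> \<le> (\<Sum>k\<le>Suc n. B * (poly (cheb (Suc n)) (y k) / w k))"
  proof (rule sum_mono)
    fix k assume "k \<in> {..Suc n}"
    then have "poly (cheb (Suc n)) (y k) / w k = 1 / \<bar>w k\<bar>"
      using w by simp
    moreover have "\<bar>poly q (y k)\<bar> / \<bar>w k\<bar> \<le> B / \<bar>w k\<bar>"
      using B[of "y k"] cheb_ext_in_I by (intro divide_right_mono) (auto simp: y_def)
    ultimately show "\<bar>poly q (y k) / w k\<bar> \<le> B * (poly (cheb (Suc n)) (y k) / w k)"
      by simp
  qed
  also have "\<dots> = B * coeff (cheb (Suc n)) (Suc n)"
    using lead_coeff_interpolation[where y = y, OF y degree_cheb_le]
    unfolding w_def by (simp only: sum_distrib_left)
  finally show ?thesis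
    by (simp add: coeff_cheb)
qed

lemma poly_best_approx:
  assumes q: "degree q \<le> Suc n"
  defines "f \<equiv> restrict (poly q) I"
  shows "(INF p\<in>Pi_poly n. sup_norm (\<lambda>x. f x - p x))
    = sup_norm (nth_deriv (Suc n) f) / (2 ^ n * fact (Suc n))"
proof -
  define a where "a = coeff q (Suc n)"
  have f: "f \<in> C_diff (Suc n)"
    by (simp add: f_def poly_in_C_diff)
  have "nth_deriv (Suc n) f x = fact (Suc n) * a" if "x \<in> I" for x
    using nth_deriv_poly[OF that, of "Suc n" q] higher_pderiv_degree_le[OF q]
    by (simp add: f_def a_def del: nth_deriv.simps funpow.simps fact_Suc)
  then have "sup_norm (nth_deriv (Suc n) f) = \<bar>fact (Suc n) * a\<bar>"
    by (rule sup_norm_const)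
  then have rhs: "sup_norm (nth_deriv (Suc n) f) / (2 ^ n * fact (Suc n)) = \<bar>a\<bar> / 2 ^ n"
    by (simp add: abs_mult del: fact_Suc)
  define p where "p = q - smult (a / 2 ^ n) (cheb (Suc n))"
  have "degree p \<le> Suc n"
    unfolding p_def using q degree_cheb_le
    by (intro degree_diff_le) (auto intro: order_trans[OF degree_smult_le])
  moreover have "coeff p (Suc n) = 0"
    by (simp add: p_def a_def coeff_cheb del: cheb.simps)
  ultimately have "degree p \<le> n"
    by (rule degree_le_if_coeff_eq_0)
  have "(INF p\<in>Pi_poly n. sup_norm (\<lambda>x. f x - p x)) \<le> sup_norm (\<lambda>x. f x - restrict (poly p) I x)"
    using f \<open>degree p \<le> n\<close> by (rule best_approx_le)
  also have "\<dots> \<le> \<bar>a\<bar> / 2 ^ n"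
  proof (rule sup_norm_le)
    fix x assume x: "x \<in> I"
    then have "f x - restrict (poly p) I x = a / 2 ^ n * poly (cheb (Suc n)) x"
      by (simp add: f_def p_def)
    then show "\<bar>f x - restrict (poly p) I x\<bar> \<le> \<bar>a\<bar> / 2 ^ n"
      using mult_left_mono[OF abs_cheb_le_1[OF x, of "Suc n"], of "\<bar>a\<bar> / 2 ^ n"]
      by (simp add: abs_mult)
  qed
  finally have "(INF p\<in>Pi_poly n. sup_norm (\<lambda>x. f x - p x)) \<le> \<bar>a\<bar> / 2 ^ n" .
  moreover have "\<bar>a\<bar> / 2 ^ n \<le> (INF p\<in>Pi_poly n. sup_norm (\<lambda>x. f x - p x))"
    using f
  proof (rule best_approx_ge)
    fix p B assume p: "degree p \<le> n" and B: "\<And>x. x \<in> I \<Longrightarrow> \<bar>f x - poly p x\<bar> \<le> B"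
    \<comment> \<open>Subtracting \<open>p\<close> leaves the coefficient \<open>a\<close>
      unchanged, so a bound on the error bounds \<open>a\<close>.\<close>
    have "\<bar>coeff (q - p) (Suc n)\<bar> \<le> B * 2 ^ n"
      using q p B by (intro abs_coeff_le_cheb degree_diff_le) (auto simp: f_def)
    then show "\<bar>a\<bar> / 2 ^ n \<le> B"
      using p by (simp add: a_def coeff_eq_0 field_simps)
  qed
  ultimately show ?thesis
    using rhs by simp
qed

section \<open>Extremal functions\<close>

text \<open>A small step along \<open>s\<close> lowers \<open>\<bar>r\<bar>\<close> wherever
  \<open>r\<close> and \<open>s\<close> have the same sign. The remaining set \<open>K\<close> is
  compact and contains no point with \<open>\<bar>r x\<bar> = E\<close>, so
  \<open>\<bar>r\<bar>\<close> stays below \<open>E\<close> there by a fixed gap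
  \<open>\<eta>\<close>, which the step does not use up.\<close>

lemma sup_norm_improvement:
  assumes r: "continuous_on I r" and s: "continuous_on I s" and "0 < E"
    and le: "\<And>x. x \<in> I \<Longrightarrow> \<bar>r x\<bar> \<le> E"
    and pos: "\<And>x. x \<in> I \<Longrightarrow> \<bar>r x\<bar> = E \<Longrightarrow> 0 < r x * s x"
  shows "\<exists>\<epsilon>. sup_norm (\<lambda>x. r x - \<epsilon> * s x) < E"
proof -
  define K where "K = {x \<in> I. r x * s x \<le> 0}"
  have "K = I \<inter> (\<lambda>x. r x * s x) -` {..0}"
    by (auto simp: K_def)
  then have "closed K"
    using continuous_on_closed_vimage[of I "\<lambda>x. r x * s x"] continuous_on_mult[OF r s]
    by (metis closed_atLeastAtMost closed_atMost Int_commute)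
  moreover have "K \<subseteq> I"
    by (auto simp: K_def)
  ultimately have "compact K"
    using compact_Int_closed[of I K] by (simp only: compact_Icc Int_absorb1)
  obtain \<eta> where \<eta>: "0 < \<eta>" "\<eta> \<le> E" "\<And>x. x \<in> K \<Longrightarrow> \<bar>r x\<bar> \<le> E - \<eta>"
  proof (cases "K = {}")
    case True
    then show ?thesis
      using that[of E] \<open>0 < E\<close> by auto
  next
    case False
    have "continuous_on K (\<lambda>x. \<bar>r x\<bar>)"
      by (rule continuous_on_rabs, rule continuous_on_subset[OF r]) (auto simp: K_def)
    then obtain z where z: "z \<in> K" "\<And>x. x \<in> K \<Longrightarrow> \<bar>r x\<bar> \<le> \<bar>r z\<bar>"
      using continuous_attains_sup[OF \<open>compact K\<close> False] by blast
    have "\<bar>r z\<bar> \<noteq> E"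
      using pos[of z] z(1) by (auto simp: K_def)
    then have "\<bar>r z\<bar> < E"
      using le[of z] z(1) by (auto simp: K_def)
    then show ?thesis
      using that[of "E - \<bar>r z\<bar>"] z(2) by auto
  qed
  \<comment> \<open>Adding 1 keeps \<open>B\<close> positive even if \<open>s\<close> vanishes on
    \<open>I\<close>, and makes the bound strict.\<close>
  define B where "B = sup_norm s + 1"
  have B: "0 < B" "\<And>x. x \<in> I \<Longrightarrow> \<bar>s x\<bar> < B"
    using sup_norm_nonneg[OF s] abs_le_sup_norm[OF s] by (force simp: B_def)+
  define \<epsilon> where "\<epsilon> = \<eta> / B"
  have "0 < \<epsilon>"
    using \<eta> B by (simp add: \<epsilon>_def)
  have strict: "\<bar>r x - \<epsilon> * s x\<bar> < E" if x: "x \<in> I" for x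
  proof -
    have "\<epsilon> * \<bar>s x\<bar> < \<epsilon> * B"
      using B(2)[OF x] \<open>0 < \<epsilon>\<close> by simp
    also have "\<epsilon> * B = \<eta>"
      using B(1) by (simp add: \<epsilon>_def)
    finally have small: "\<bar>\<epsilon> * s x\<bar> < \<eta>"
      using \<open>0 < \<epsilon>\<close> by (simp add: abs_mult)
    show ?thesis
    proof (cases "x \<in> K")
      case True
      then show ?thesis
        using \<eta>(3)[OF True] small by linarith
    next
      case False
      then have "0 < r x * s x"
        using x by (simp add: K_def)
      \<comment> \<open>The step moves \<open>r x\<close> towards 0, and as it is shorter than
        \<open>\<eta> \<le> E\<close> it cannot overshoot to modulus \<open>E\<close> on the other
        side.\<close>
      then have "0 < r x \<and> 0 < \<epsilon> * s x \<or> r x < 0 \<and> \<epsilon> * s x < 0"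
        using \<open>0 < \<epsilon>\<close> by (auto simp: zero_less_mult_iff mult_less_0_iff)
      then show ?thesis
        using small le[OF x] \<eta>(2) by linarith
    qed
  qed
  have "continuous_on I (\<lambda>x. r x - \<epsilon> * s x)"
    by (intro continuous_intros r s)
  then obtain z where "z \<in> I" "sup_norm (\<lambda>x. r x - \<epsilon> * s x) = \<bar>r z - \<epsilon> * s z\<bar>"
    by (rule sup_norm_attained)
  with strict show ?thesis
    by metis
qed

text \<open>If the values \<open>b k = (-1) ^ k * r (y k)\<close> were neither all \<open>E\<close> nor all \<open>- E\<close>, subtracting their mean
  would give coefficients that sum to \<open>0\<close> and keep the sign of \<open>b k\<close> wherever \<open>\<bar>b k\<bar> = E\<close>. The
  combination of the nodal polynomials with these coefficients has degree at most \<open>n\<close> and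
  improves the approximation.\<close>

lemma alternation:
  fixes r :: "real \<Rightarrow> real" and n :: nat
  defines "y \<equiv> cheb_ext (Suc n)"
  assumes r: "continuous_on I r"
    and le: "\<And>x. x \<in> I \<Longrightarrow> \<bar>r x\<bar> \<le> E * \<bar>poly (cheb (Suc n)) x\<bar>"
    and best: "\<And>s. degree s \<le> n \<Longrightarrow> E \<le> sup_norm (\<lambda>x. r x - poly s x)"
  shows "\<exists>\<sigma>\<in>{1, - 1}. \<forall>k\<le>Suc n. r (y k) = \<sigma> * E * poly (cheb (Suc n)) (y k)"
proof -
  define b where "b = (\<lambda>k. (- 1) ^ k * r (y k))"
  have ry: "r (y k) = (- 1) ^ k * b k" for k
    by (simp add: b_def flip: mult.assoc power_add)
  have Ty: "poly (cheb (Suc n)) (y k) = (- 1) ^ k" for k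
    by (simp add: y_def poly_cheb_ext del: cheb.simps)
  have b_le: "\<bar>b k\<bar> \<le> E" for k
    using le[of "y k"] cheb_ext_in_I Ty[of k] by (simp add: b_def y_def abs_mult del: cheb.simps)
  have yI: "y k \<in> I" for k
    unfolding y_def by (rule cheb_ext_in_I)
  have "(\<forall>k\<le>Suc n. b k = E) \<or> (\<forall>k\<le>Suc n. b k = - E)"
  proof (rule ccontr)
    assume "\<not> ?thesis"
    then obtain i j where ij: "i \<le> Suc n" "b i \<noteq> E" "j \<le> Suc n" "b j \<noteq> - E"
      by blast
    \<comment> \<open>For \<open>E = 0\<close> the bound on \<open>b i\<close> would force
      \<open>b i = E\<close>.\<close>
    then have "E \<noteq> 0"
      using b_le[of i] by auto
    then have "0 < E"
      using b_le[of i] by linarith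
    define \<mu> where "\<mu> = (\<Sum>k\<le>Suc n. b k) / real (Suc (Suc n))"
    have "(\<Sum>k\<le>Suc n. b k) < (\<Sum>k\<le>Suc n. E)"
      using ij b_le by (intro sum_strict_mono_ex1) (force simp: abs_le_iff order.strict_iff_order)+
    then have "\<mu> < E"
      by (simp add: \<mu>_def field_simps)
    have "(\<Sum>k\<le>Suc n. - E) < (\<Sum>k\<le>Suc n. b k)"
    proof (intro sum_strict_mono_ex1)
      show "\<forall>k\<in>{..Suc n}. - E \<le> b k"
        using b_le by (meson abs_le_D2 minus_le_iff)
      then show "\<exists>k\<in>{..Suc n}. - E < b k"
        using ij by (intro bexI[of _ j]) (auto simp: order.strict_iff_order)
    qed simp
    then have "- E < \<mu>"
      by (simp add: \<mu>_def field_simps)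
    define \<omega> where "\<omega> = (\<lambda>k. nodal y ({..Suc n} - {k}))"
    have \<omega>: "0 < (- 1) ^ k * poly (\<omega> k) (y k)" if "k \<le> Suc n" for k
      unfolding \<omega>_def by (rule nodal_sign) (simp_all add: y_def cheb_ext_decreasing that)
    define s where "s = (\<Sum>k\<le>Suc n. smult (b k - \<mu>) (\<omega> k))"
    have sy: "poly s (y j) = (b j - \<mu>) * poly (\<omega> j) (y j)" if "j \<le> Suc n" for j
    proof -
      have "poly s (y j) = (\<Sum>k\<le>Suc n. if k = j then (b j - \<mu>) * poly (\<omega> j) (y j) else 0)"
        unfolding s_def poly_sum using that
        by (intro sum.cong) (auto simp: \<omega>_def intro!: nodal_eq_0)
      then show ?thesis
        using that by simp
    qed
    have coeff_\<omega>: "coeff (\<omega> k) (Suc n) = 1" if "k \<le> Suc n" for k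
      using lead_coeff_nodal[of y "{..Suc n} - {k}"] that by (simp add: \<omega>_def)
    have "degree s \<le> Suc n"
      unfolding s_def
      by (intro degree_sum_le) (auto simp: \<omega>_def intro: order_trans[OF degree_smult_le])
    moreover have "coeff s (Suc n) = (\<Sum>k\<le>Suc n. b k - \<mu>)"
      unfolding s_def coeff_sum by (intro sum.cong) (auto simp: coeff_\<omega>)
    then have "coeff s (Suc n) = 0"
      by (simp add: sum_subtractf \<mu>_def del: sum.atMost_Suc)
    ultimately have ds: "degree s \<le> n"
      by (rule degree_le_if_coeff_eq_0)
    have pos: "0 < r x * poly s x" if x: "x \<in> I" "\<bar>r x\<bar> = E" for x
    proof -
      \<comment> \<open>The majorant \<open>E * \<bar>cheb\<bar>\<close> confines the points where
        \<open>\<bar>r x\<bar> = E\<close> to the nodes, so the sign condition has to be checked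
        only there.\<close>
      have "1 \<le> \<bar>poly (cheb (Suc n)) x\<bar>"
        using le[OF x(1)] x(2) \<open>0 < E\<close> by (simp add: del: cheb.simps)
      then have "\<bar>poly (cheb (Suc n)) x\<bar> = 1"
        using abs_cheb_le_1[OF x(1), of "Suc n"] by linarith
      then obtain k where k: "k \<le> Suc n" "x = y k"
        using cheb_extremal_points[of "Suc n" x] x(1) by (auto simp: y_def)
      have "\<bar>b k\<bar> = E"
        using x(2) k(2) by (simp add: b_def abs_mult)
      then have "0 < b k * (b k - \<mu>)"
        using \<open>\<mu> < E\<close> \<open>- E < \<mu>\<close> \<open>0 < E\<close> by (auto simp: abs_if zero_less_mult_iff split: if_splits)
      then have "0 < (b k * (b k - \<mu>)) * ((- 1) ^ k * poly (\<omega> k) (y k))"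
        using \<omega>[OF k(1)] by (rule mult_pos_pos)
      then show ?thesis
        unfolding k(2) ry sy[OF k(1)] by (simp add: mult_ac)
    qed
    have leE: "\<bar>r x\<bar> \<le> E" if "x \<in> I" for x
      using le[OF that] mult_left_mono[OF abs_cheb_le_1[OF that, of "Suc n"], of E] \<open>0 < E\<close>
      by linarith
    obtain \<epsilon> where "sup_norm (\<lambda>x. r x - \<epsilon> * poly s x) < E"
      using sup_norm_improvement[of r "poly s" E] r leE pos \<open>0 < E\<close> continuous_on_poly[OF continuous_on_id, of I s]
      by blast
    moreover have "E \<le> sup_norm (\<lambda>x. r x - poly (smult \<epsilon> s) x)"
      using ds by (intro best) (auto intro: order_trans[OF degree_smult_le])
    ultimately show False
      by simp
  qed
  then show ?thesis
    by (auto simp: ry Ty simp del: cheb.simps)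
qed

text \<open>Interpolating \<open>f\<close> at all nodes but the first, and at all nodes but the last, gives two
  factorisations of \<open>f - P\<close> whose product is nonpositive.\<close>

lemma eq_poly_if_one_sided_derivative:
  assumes f: "f \<in> C_diff (Suc n)" and P: "degree P \<le> Suc n"
    and y: "\<And>i j. i < j \<Longrightarrow> j \<le> Suc n \<Longrightarrow> y j < y i" "y 0 = 1" "y (Suc n) = - 1"
    and fy: "\<And>k. k \<le> Suc n \<Longrightarrow> f (y k) = poly P (y k)"
    and one_sided: "\<And>u v. u \<in> I \<Longrightarrow> v \<in> I \<Longrightarrow>
      0 \<le> (nth_deriv (Suc n) f u - fact (Suc n) * coeff P (Suc n))
        * (nth_deriv (Suc n) f v - fact (Suc n) * coeff P (Suc n))"
    and x: "x \<in> I"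
  shows "f x = poly P x"
proof -
  define h where "h = (\<lambda>u. nth_deriv (Suc n) f u - fact (Suc n) * coeff P (Suc n))"
  have inj: "inj_on y {..Suc n}"
    by (rule linorder_inj_onI) (use y in \<open>force+\<close>)
  have yI: "y k \<in> I" if "k \<le> Suc n" for k
    using y(1)[of 0 k] y(1)[of k "Suc n"] y(2,3) that by (cases "k = 0"; cases "k = Suc n") force+
  have err: "\<exists>\<xi>\<in>I. f x - poly P x = h \<xi> / fact (Suc n) * poly (nodal y A) x"
    if "A \<subseteq> {..Suc n}" "card A = Suc n" for A
  proof -
    have "\<exists>\<xi>\<in>I. f x - poly P x = (nth_deriv (Suc n) f \<xi> - fact (Suc n) * coeff P (Suc n))
        / (fact (Suc n) * lead_coeff (nodal y A)) * poly (nodal y A) x"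
    proof (rule interpolation_error[OF f, where Z = "y ` A"])
      show "card (y ` A) = Suc n"
        using inj_on_subset[OF inj that(1)] that(2) by (simp add: card_image)
    qed (use that P x yI fy finite_subset[OF that(1)] in \<open>auto simp: nodal_eq_0\<close>)
    then show ?thesis
      using that(2) lead_coeff_nodal[of y A]
      by (simp add: h_def del: nth_deriv.simps fact_Suc)
  qed
  define C where "C = {1..n}"
  obtain u where u: "u \<in> I" "f x - poly P x = h u / fact (Suc n) * poly (nodal y (insert 0 C)) x"
    using err[of "insert 0 C"] by (auto simp: C_def)
  obtain v where v: "v \<in> I"
      "f x - poly P x = h v / fact (Suc n) * poly (nodal y (insert (Suc n) C)) x"
    using err[of "insert (Suc n) C"] by (auto simp: C_def)
  have "(f x - poly P x)\<^sup>2
      = (h u / fact (Suc n) * poly (nodal y (insert 0 C)) x)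
        * (h v / fact (Suc n) * poly (nodal y (insert (Suc n) C)) x)"
    unfolding power2_eq_square using u(2) v(2) by metis
  \<comment> \<open>The common nodes give the square; the two endpoint nodes give
    \<open>x - 1\<close> and \<open>x + 1\<close>, whose product is nonpositive on
    \<open>I\<close>.\<close>
  also have "\<dots> = - ((h u * h v) * ((1 - x) * (1 + x)) * (poly (nodal y C) x / fact (Suc n))\<^sup>2)"
    using y(2,3) by (simp add: C_def poly_nodal power2_eq_square field_simps del: fact_Suc)
  also have "\<dots> \<le> 0"
  proof -
    have "0 \<le> h u * h v"
      using one_sided[OF u(1) v(1)] by (simp only: h_def)
    moreover have "0 \<le> (1 - x) * (1 + x)"
      using x by simp
    ultimately show ?thesis
      using mult_nonneg_nonneg[OF mult_nonneg_nonneg zero_le_power2]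
      by (simp only: neg_le_0_iff_le)
  qed
  finally show ?thesis
    by simp
qed

lemma extremal_imp_poly:
  assumes f: "f \<in> C_diff (Suc n)"
    and eq: "(INF p\<in>Pi_poly n. sup_norm (\<lambda>x. f x - p x))
      = sup_norm (nth_deriv (Suc n) f) / (2 ^ n * fact (Suc n))"
  shows "f \<in> Pi_poly (Suc n)"
proof -
  define M where "M = sup_norm (nth_deriv (Suc n) f)"
  define E where "E = M / (2 ^ n * fact (Suc n))"
  define y where "y = cheb_ext (Suc n)"
  have M: "\<bar>nth_deriv (Suc n) f x\<bar> \<le> M" if "x \<in> I" for x
    unfolding M_def using continuous_on_nth_deriv[OF f order_refl] that by (rule abs_le_sup_norm)
  obtain Z where Z: "finite Z" "Z \<subseteq> I" "card Z = Suc n" "\<forall>z\<in>Z. poly (cheb (Suc n)) z = 0"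
    using cheb_zeros by blast
  obtain p where p: "degree p \<le> n" "\<forall>z\<in>Z. poly p z = f z"
    using interpolation_poly_exists[OF Z(1), of f] Z(3) by (metis card.empty less_Suc_eq_le nat.distinct(1))
  define r where "r = (\<lambda>x. f x - poly p x)"
  have r: "continuous_on I r"
    unfolding r_def using continuous_on_nth_deriv[OF f, of 0]
    by (auto intro!: continuous_on_diff continuous_on_poly[OF continuous_on_id])
  have r_le: "\<bar>r x\<bar> \<le> E * \<bar>poly (cheb (Suc n)) x\<bar>" if x: "x \<in> I" for x
  proof -
    have "cheb (Suc n) \<noteq> 0"
      using degree_cheb[of n] by (metis degree_0 nat.distinct(1))
    then obtain \<xi> where \<xi>: "\<xi> \<in> I"
      "r x = (nth_deriv (Suc n) f \<xi> - fact (Suc n) * coeff p (Suc n))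
        / (fact (Suc n) * lead_coeff (cheb (Suc n))) * poly (cheb (Suc n)) x"
      using interpolation_error[OF f degree_cheb Z(1-3), of p x] Z(4) p x
      unfolding r_def by fastforce
    \<comment> \<open>The coefficient of \<open>p\<close> vanishes by its degree, and the leading
      coefficient \<open>2 ^ n\<close> produces exactly the denominator of \<open>E\<close>.\<close>
    then have "r x = nth_deriv (Suc n) f \<xi> / (2 ^ n * fact (Suc n)) * poly (cheb (Suc n)) x"
      using p(1) by (simp add: coeff_eq_0 degree_cheb coeff_cheb mult.commute
          del: cheb.simps nth_deriv.simps fact_Suc)
    then have "\<bar>r x\<bar> = \<bar>nth_deriv (Suc n) f \<xi>\<bar> / (2 ^ n * fact (Suc n)) * \<bar>poly (cheb (Suc n)) x\<bar>"
      by (simp add: abs_mult del: cheb.simps nth_deriv.simps fact_Suc)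
    then show ?thesis
      unfolding E_def using M[OF \<xi>(1)]
      by (simp only:) (intro mult_right_mono divide_right_mono, auto)
  qed
  have best: "E \<le> sup_norm (\<lambda>x. r x - poly s x)" if "degree s \<le> n" for s
  proof -
    \<comment> \<open>Extremality of \<open>f\<close> is applied to the competitor
      \<open>p + s\<close>.\<close>
    have "E \<le> sup_norm (\<lambda>x. f x - restrict (poly (p + s)) I x)"
      using best_approx_le[OF f degree_add_le[OF p(1) that]] eq by (simp only: E_def M_def)
    also have "\<dots> = sup_norm (\<lambda>x. r x - poly s x)"
      unfolding sup_norm_def r_def by (intro SUP_cong) auto
    finally show ?thesis .
  qed
  obtain \<sigma> where \<sigma>: "\<sigma> \<in> {1, - 1}"
      "\<forall>k\<le>Suc n. r (y k) = \<sigma> * E * poly (cheb (Suc n)) (y k)"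
    using alternation[OF r r_le best] unfolding y_def by blast
  define P where "P = p + smult (\<sigma> * E) (cheb (Suc n))"
  have P: "degree P \<le> Suc n"
    unfolding P_def using p(1) degree_cheb_le[of "Suc n"]
    by (intro degree_add_le) (auto intro: order_trans[OF degree_smult_le])
  have "fact (Suc n) * coeff P (Suc n) = \<sigma> * M"
    using p(1) by (simp add: P_def E_def coeff_eq_0 coeff_cheb del: cheb.simps fact_Suc)
  have "f x = poly P x" if "x \<in> I" for x
  proof (rule eq_poly_if_one_sided_derivative[OF f P, where y = y])
    fix u v :: real assume "u \<in> I" "v \<in> I"
    then have "\<bar>nth_deriv (Suc n) f u\<bar> \<le> M" "\<bar>nth_deriv (Suc n) f v\<bar> \<le> M"
      using M by blast+
    \<comment> \<open>Subtracting \<open>\<sigma> * M\<close> from a value of modulus at most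
      \<open>M\<close> leaves either zero or the sign of \<open>- \<sigma>\<close>, for both
      factors.\<close>
    then show "0 \<le> (nth_deriv (Suc n) f u - fact (Suc n) * coeff P (Suc n))
        * (nth_deriv (Suc n) f v - fact (Suc n) * coeff P (Suc n))"
      unfolding \<open>fact (Suc n) * coeff P (Suc n) = \<sigma> * M\<close>
      using \<sigma>(1) by (auto simp: zero_le_mult_iff simp del: nth_deriv.simps)
  qed (use \<sigma>(2) that in \<open>auto simp: y_def cheb_ext_decreasing cheb_ext_0 cheb_ext_N r_def P_def
      algebra_simps simp del: cheb.simps\<close>)
  then have "f = restrict (poly P) I"
    using f by (intro extensionalityI[of _ I]) (auto simp: C_diff_def)
  then show ?thesis
    using P by (auto simp: Pi_poly_def)
qed

theorem mainTheorem1: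
  fixes n :: nat and H :: "(real \<Rightarrow> real) set"
  assumes "H = {f \<in> C_diff (n + 1).
                 (INF p\<in>Pi_poly n. sup_norm (\<lambda>x. f x - p x))
                   = sup_norm (nth_deriv (n + 1) f) / (2 ^ n * fact (n + 1))}"
  shows "H = Pi_poly (n + 1)"
proof
  show "H \<subseteq> Pi_poly (n + 1)"
    using extremal_imp_poly[of _ n] by (auto simp: assms simp del: nth_deriv.simps fact_Suc)
  show "Pi_poly (n + 1) \<subseteq> H"
  proof
    fix f assume "f \<in> Pi_poly (n + 1)"
    then obtain q where q: "f = restrict (poly q) I" "degree q \<le> Suc n"
      by (auto simp: Pi_poly_def)
    show "f \<in> H"
      using poly_best_approx[OF q(2)] poly_in_C_diff[of q "Suc n"]
      by (simp add: assms q(1) del: nth_deriv.simps fact_Suc restrict_apply)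
  qed
qed

end
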